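(* Let $n\ge 1$ and let $P\subseteq\mathbb{R}^n$ be a polytope. Then there exists a zonotope $Z\subseteq\mathbb{R}^n$ such that $P+Z$ is vertex generated.
   Context: A polytope is the convex hull of a finite non-empty set of points; $V(P)$ denotes the set of vertices of the polytope $P$; $A+B=\{a+b:a\in A,b\in B\}$ is the Minkowski sum. A zonotope is the Minkowski sum of a finite number of line segments. A polytope $P\subset\mathbb{R}^n$ is called vertex generated if $P+V(P)=2P$. *)

theory Defs
  imports "HOL-Analysis.Analysis"
begin

text \<open>
  Addition of sets is the Minkowski sum (from HOL-Library.Set_Algebras), so \<open>\<Sum>\<close> over a family
  of sets is an iterated Minkowski sum, and the empty sum is \<open>{0}\<close>.
  The library predicate \<^const>\<open>polytope\<close> also holds of the empty set; where a polytope is meant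
  to be non-empty, this is required separately.
\<close>

definition vertices :: "'a::real_vector set \<Rightarrow> 'a set" where
  "vertices P = {v. v extreme_point_of P}"

text \<open>Segments may degenerate to points, and repeated summands are allowed.\<close>

definition zonotope :: "'a::real_vector set \<Rightarrow> bool" where
  "zonotope Z \<longleftrightarrow> (\<exists>(m::nat) a b. Z = (\<Sum>i<m. closed_segment (a i) (b i)))"

definition vertex_generated :: "'a::real_vector set \<Rightarrow> bool" where
  "vertex_generated P \<longleftrightarrow> polytope P \<and> P \<noteq> {} \<and> P + vertices P = (*\<^sub>R) 2 ` P"

end

theory Submission
  imports Defs
begin

text \<open>
  The sum \<open>Q = P + Z\<close> is vertex generated iff every \<open>x \<in> Q\<close> has a vertex \<open>w\<close> of \<open>Q\<close> with \<open>2x - w \<in> Q\<close>.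
  Let \<open>P\<close> be the hull of a finite set \<open>W\<close> and \<open>Z\<close> the sum of the segments from \<open>- e\<close> to \<open>e\<close>.
  Write \<open>x = p + \<Sum> t\<^sub>e e\<close> with \<open>\<Sum> t\<^sub>e\<^sup>2\<close> minimal: by Lagrange duality there is \<open>u\<^sub>0\<close> maximized over \<open>P\<close> at
  \<open>p\<close> such that every nonzero \<open>t\<^sub>e\<close> has the sign of \<open>u\<^sub>0 \<bullet> e\<close>. Directions \<open>e\<close> parallel to the face \<open>F\<close> of
  \<open>P\<close> exposed by \<open>u\<^sub>0\<close> thus have \<open>t\<^sub>e = 0\<close> and are free to treat \<open>p \<in> F\<close> itself: if some \<open>u\<^sub>1\<close> has its
  strict maximum over \<open>F\<close> at \<open>a\<close> and \<open>p = (a + b)/2 + \<Sum> c\<^sub>e e\<close> with \<open>b \<in> F\<close> and \<open>c\<^sub>e\<close> of the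
  sign of \<open>u\<^sub>1 \<bullet> e\<close>, then a generic perturbation of \<open>u\<^sub>0 + \<epsilon> u\<^sub>1\<close> selects a vertex \<open>w\<close> as required.
  Such \<open>u\<^sub>1\<close> exists, with finitely many directions near a given \<open>p\<close>, unless \<open>p\<close> is a centre of
  symmetry of \<open>F\<close>; in that case \<open>b = 2p - a\<close> and the directions \<open>v - p\<close> (\<open>v\<close> a vertex of \<open>F\<close>) serve
  all of \<open>F\<close>. Compactness of each of the finitely many faces leaves finitely many directions in all.
\<close>

subsection \<open>Sums of segments\<close>

lemma polytope_set_plus:
  fixes S T :: "'a::real_vector set"
  assumes "polytope S" "polytope T"
  shows "polytope (S + T)"
proof -
  have "linear (\<lambda>z::'a \<times> 'a. fst z + snd z)"
    by (intro linear_compose_add linear_fst linear_snd)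
  moreover have "S + T = (\<lambda>z. fst z + snd z) ` (S \<times> T)"
    by (force simp: set_plus_def)
  ultimately show ?thesis
    using assms polytope_linear_image polytope_Times by metis
qed

lemma polytope_closed_segment: "polytope (closed_segment a b)"
  by (simp add: polytope_convex_hull segment_convex_hull)

lemma polytope_sum_segments:
  assumes "finite E"
  shows "polytope (\<Sum>e\<in>E. closed_segment (a e) (b e))"
  using assms
  by (induction E) (auto simp: polytope_set_plus polytope_closed_segment polytope_sing set_zero)

lemma closed_segment_scaleR:
  assumes "l \<le> r"
  shows "closed_segment (l *\<^sub>R e) (r *\<^sub>R e) = {s *\<^sub>R e | s. l \<le> s \<and> s \<le> r}"
proof -
  have "linear (\<lambda>s. s *\<^sub>R e)"
    by (simp add: linear_scaleR_left)
  from closed_segment_linear_image[OF this, of l r]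
  show ?thesis
    using assms by (auto simp: closed_segment_eq_real_ivl)
qed

text \<open>The bounds and the vectors \<open>f e\<close> stay general: besides symmetric segments,
  asymmetric ranges of coefficient changes in a product space occur below.\<close>

lemma sum_closed_segments_scaleR:
  assumes "finite E" "\<And>e. e \<in> E \<Longrightarrow> l e \<le> r e"
  shows "(\<Sum>e\<in>E. closed_segment (l e *\<^sub>R f e) (r e *\<^sub>R f e)) =
    {(\<Sum>e\<in>E. t e *\<^sub>R f e) | t. \<forall>e\<in>E. l e \<le> t e \<and> t e \<le> r e}"
proof -
  have "{sum s E |s. \<forall>e\<in>E. s e \<in> closed_segment (l e *\<^sub>R f e) (r e *\<^sub>R f e)} =
    {(\<Sum>e\<in>E. t e *\<^sub>R f e) | t. \<forall>e\<in>E. l e \<le> t e \<and> t e \<le> r e}" (is "?L = ?R")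
  proof
    show "?L \<subseteq> ?R"
    proof clarify
      fix s assume "\<forall>e\<in>E. s e \<in> closed_segment (l e *\<^sub>R f e) (r e *\<^sub>R f e)"
      then have "\<forall>e\<in>E. \<exists>c. s e = c *\<^sub>R f e \<and> l e \<le> c \<and> c \<le> r e"
        using assms(2) closed_segment_scaleR by fastforce
      then obtain t where "\<forall>e\<in>E. s e = t e *\<^sub>R f e \<and> l e \<le> t e \<and> t e \<le> r e"
        by metis
      then show "\<exists>t. sum s E = (\<Sum>e\<in>E. t e *\<^sub>R f e) \<and> (\<forall>e\<in>E. l e \<le> t e \<and> t e \<le> r e)"
        by (intro exI[of _ t]) auto
    qed
    show "?R \<subseteq> ?L"
    proof clarify
      fix t assume t: "\<forall>e\<in>E. l e \<le> t e \<and> t e \<le> r e"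
      show "\<exists>s. (\<Sum>e\<in>E. t e *\<^sub>R f e) = sum s E \<and>
          (\<forall>e\<in>E. s e \<in> closed_segment (l e *\<^sub>R f e) (r e *\<^sub>R f e))"
        using t assms(2) by (intro exI[of _ "\<lambda>e. t e *\<^sub>R f e"]) (auto simp: closed_segment_scaleR)
    qed
  qed
  then show ?thesis
    by (simp only: set_sum_alt[OF assms(1)])
qed

lemma sum_segments_symmetric:
  assumes "finite E"
  shows "(\<Sum>e\<in>E. closed_segment (- e) e) = {(\<Sum>e\<in>E. t e *\<^sub>R e) | t. \<forall>e\<in>E. \<bar>t e\<bar> \<le> 1}"
  using sum_closed_segments_scaleR[OF assms, of "\<lambda>_. -1" "\<lambda>_. 1" "\<lambda>e. e"]
  by (simp add: abs_le_iff minus_le_iff conj_commute)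

lemma zonotope_sum_segments:
  assumes "finite E"
  shows "zonotope (\<Sum>e\<in>E. closed_segment (a e) (b e))"
proof -
  obtain h where "bij_betw h {..<card E} E"
    using ex_bij_betw_nat_finite[OF assms] by (auto simp: atLeast0LessThan)
  then have "(\<Sum>e\<in>E. closed_segment (a e) (b e)) =
      (\<Sum>i<card E. closed_segment (a (h i)) (b (h i)))"
    by (rule sum.reindex_bij_betw[symmetric])
  then show ?thesis
    unfolding zonotope_def by (intro exI) assumption
qed

subsection \<open>Sign-compatible decompositions\<close>

lemma compact_Pi_UNIV:
  fixes B :: "'a \<Rightarrow> 'b::topological_space set"
  assumes "\<And>i. compact (B i)"
  shows "compact {t. \<forall>i. t i \<in> B i}"
proof -
  have "compactin (product_topology (\<lambda>i. euclidean) UNIV) (PiE UNIV B)"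
    using assms by (simp add: compactin_PiE)
  moreover have "PiE UNIV B = {t. \<forall>i. t i \<in> B i}"
    by (auto simp: PiE_iff)
  ultimately show ?thesis
    by (simp add: euclidean_product_topology)
qed

text \<open>The coefficients determine the point of \<open>P\<close>, so the admissible families
  form a compact set, on which the sum of squares attains its minimum.\<close>

lemma least_square_decomposition:
  fixes x :: "'a::euclidean_space"
  assumes "finite E" and "compact P" and "p0 \<in> P" and "\<forall>e\<in>E. \<bar>t0 e\<bar> \<le> 1"
    and "x = p0 + (\<Sum>e\<in>E. t0 e *\<^sub>R e)"
  obtains p t where "p \<in> P" "\<forall>e\<in>E. \<bar>t e\<bar> \<le> 1" "x = p + (\<Sum>e\<in>E. t e *\<^sub>R e)"
    "\<And>q s. q \<in> P \<Longrightarrow> \<forall>e\<in>E. \<bar>s e\<bar> \<le> 1 \<Longrightarrow> x = q + (\<Sum>e\<in>E. s e *\<^sub>R e) \<Longrightarrow>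
      (\<Sum>e\<in>E. (t e)\<^sup>2) \<le> (\<Sum>e\<in>E. (s e)\<^sup>2)"
proof -
  \<comment> \<open>Coefficients outside \<open>E\<close> are pinned to 0 to get a product of
    compact sets.\<close>
  define B where "B e = (if e \<in> E then {-1..1} else {0::real})" for e
  define C where "C = {t. \<forall>e. t e \<in> B e} \<inter> (\<lambda>t. x - (\<Sum>e\<in>E. t e *\<^sub>R e)) -` P"
  have co: "continuous_on UNIV (\<lambda>t::'a \<Rightarrow> real. t e)" for e
    by simp
  have "closed ((\<lambda>t. x - (\<Sum>e\<in>E. t e *\<^sub>R e)) -` P)"
    by (intro closed_vimage compact_imp_closed assms continuous_intros co)
  then have "compact C"
    unfolding C_def by (intro compact_Int_closed compact_Pi_UNIV) (simp_all add: B_def)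
  have mem: "(\<lambda>e. if e \<in> E then s e else 0) \<in> C"
    if "q \<in> P" "\<forall>e\<in>E. \<bar>s e\<bar> \<le> 1" "x = q + (\<Sum>e\<in>E. s e *\<^sub>R e)" for q s
    using that by (auto simp: C_def B_def abs_le_iff)
  have cont: "continuous_on C (\<lambda>t. \<Sum>e\<in>E. (t e)\<^sup>2)"
    by (intro continuous_on_sum continuous_on_power continuous_on_subset[OF co]) simp
  have "C \<noteq> {}"
    using mem[OF assms(3-5)] by blast
  then obtain t where t: "t \<in> C" "\<And>s. s \<in> C \<Longrightarrow> (\<Sum>e\<in>E. (t e)\<^sup>2) \<le> (\<Sum>e\<in>E. (s e)\<^sup>2)"
    using continuous_attains_inf[OF \<open>compact C\<close> _ cont] by metis
  show thesis
  proof (rule that[of "x - (\<Sum>e\<in>E. t e *\<^sub>R e)" t])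
    show "\<forall>e\<in>E. \<bar>t e\<bar> \<le> 1"
    proof
      fix e assume "e \<in> E"
      then show "\<bar>t e\<bar> \<le> 1"
        using t(1) by (auto simp: C_def B_def abs_le_iff dest!: spec[of _ e])
    qed
    fix q s assume "q \<in> P" "\<forall>e\<in>E. \<bar>s e\<bar> \<le> 1" "x = q + (\<Sum>e\<in>E. s e *\<^sub>R e)"
    from t(2)[OF mem[OF this]] show "(\<Sum>e\<in>E. (t e)\<^sup>2) \<le> (\<Sum>e\<in>E. (s e)\<^sup>2)"
      by simp
  qed (use t(1) in \<open>auto simp: C_def\<close>)
qed

text \<open>
  The multiplier \<open>u\<close> of the least-squares problem exists without any constraint qualification
  because the directions feasible at the minimizer form a polyhedral, hence closed, cone.
\<close>

lemma sign_compatible_decomposition: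
  fixes x :: "'a::euclidean_space"
  assumes E: "finite E" and P: "polytope P" and "p0 \<in> P" and "\<forall>e\<in>E. \<bar>t0 e\<bar> \<le> 1"
    and "x = p0 + (\<Sum>e\<in>E. t0 e *\<^sub>R e)"
  obtains u p t where "p \<in> P" "\<forall>e\<in>E. \<bar>t e\<bar> \<le> 1" "x = p + (\<Sum>e\<in>E. t e *\<^sub>R e)"
    "\<forall>q\<in>P. u \<bullet> q \<le> u \<bullet> p" "\<forall>e\<in>E. t e \<noteq> 0 \<longrightarrow> 0 < t e * (u \<bullet> e)"
proof -
  obtain p t where p: "p \<in> P" and t: "\<forall>e\<in>E. \<bar>t e\<bar> \<le> 1" and x: "x = p + (\<Sum>e\<in>E. t e *\<^sub>R e)"
    and min: "\<And>q s. q \<in> P \<Longrightarrow> \<forall>e\<in>E. \<bar>s e\<bar> \<le> 1 \<Longrightarrow> x = q + (\<Sum>e\<in>E. s e *\<^sub>R e) \<Longrightarrow>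
      (\<Sum>e\<in>E. (t e)\<^sup>2) \<le> (\<Sum>e\<in>E. (s e)\<^sup>2)"
    by (rule least_square_decomposition[OF E polytope_imp_compact[OF P] assms(3-5)]) (rule that)
  \<comment> \<open>\<open>K\<close> consists of the displacements from \<open>(p, t)\<close> to
    admissible \<open>(q, t + s)\<close>: first the change of the represented point, then
    \<open>\<Sum>e\<in>E. s e * t e\<close>, half the first-order change of the sum of
    squares.\<close>
  define f where "f e = (e, t e)" for e
  define K where "K = ((\<lambda>q. (q - p, 0::real)) ` P) +
    (\<Sum>e\<in>E. closed_segment ((- 1 - t e) *\<^sub>R f e) ((1 - t e) *\<^sub>R f e))"
  have "(\<lambda>q. (q - p, 0::real)) ` P = (+) (- p, 0) ` (\<lambda>q. (q, 0)) ` P"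
    by (force simp: image_iff)
  moreover have "linear (\<lambda>q::'a. (q, 0::real))"
    by (intro linearI) auto
  ultimately have "polytope ((\<lambda>q. (q - p, 0::real)) ` P)"
    by (simp add: polytope_translation_eq polytope_linear_image P)
  then have polK: "polytope K"
    unfolding K_def by (intro polytope_set_plus polytope_sum_segments E)
  have segs: "(\<Sum>e\<in>E. closed_segment ((- 1 - t e) *\<^sub>R f e) ((1 - t e) *\<^sub>R f e)) =
    {(\<Sum>e\<in>E. s e *\<^sub>R f e) | s. \<forall>e\<in>E. - 1 - t e \<le> s e \<and> s e \<le> 1 - t e}"
    by (rule sum_closed_segments_scaleR[OF E]) simp
  have KI: "(q - p, 0) + (\<Sum>e\<in>E. s e *\<^sub>R f e) \<in> K"
    if "q \<in> P" "\<forall>e\<in>E. - 1 - t e \<le> s e \<and> s e \<le> 1 - t e" for q s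
    unfolding K_def segs using that by (intro set_plus_intro) auto
  \<comment> \<open>Membership would give a move that fixes \<open>x\<close> and lowers the sum of
    squares to first order.\<close>
  have notin: "(0, -1) \<notin> conic hull K"
  proof
    assume "(0, -1) \<in> conic hull K"
    then obtain c k where "c \<ge> 0" "k \<in> K" and ck: "(0, -1) = c *\<^sub>R k"
      by (auto simp: conic_hull_explicit)
    then obtain q s where q: "q \<in> P" and s: "\<forall>e\<in>E. - 1 - t e \<le> s e \<and> s e \<le> 1 - t e"
      and k: "k = (q - p, 0) + (\<Sum>e\<in>E. s e *\<^sub>R f e)"
      unfolding K_def segs by (auto elim!: set_plus_elim)
    have k': "k = (q - p + (\<Sum>e\<in>E. s e *\<^sub>R e), \<Sum>e\<in>E. s e * t e)"
      unfolding k f_def by (simp add: prod_eq_iff fst_sum snd_sum)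
    have "c \<noteq> 0"
      using ck by (auto simp: k' zero_prod_def)
    have "q - p + (\<Sum>e\<in>E. s e *\<^sub>R e) = 0" and "c * (\<Sum>e\<in>E. s e * t e) = -1"
      using ck \<open>c \<noteq> 0\<close> by (auto simp: k')
    moreover from this(2) have neg: "(\<Sum>e\<in>E. s e * t e) < 0"
      using \<open>c \<ge> 0\<close> by (smt (verit) mult_nonneg_nonneg)
    ultimately have qp: "q + (\<Sum>e\<in>E. s e *\<^sub>R e) = p"
      by (simp add: algebra_simps)
    define m S where "m = - (\<Sum>e\<in>E. s e * t e)" and "S = (\<Sum>e\<in>E. (s e)\<^sup>2)"
    \<comment> \<open>A step of length \<open>\<theta>\<close> changes the sum of squares by
      \<open>\<theta> * (\<theta> * S - 2 * m)\<close>, negative once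
      \<open>\<theta> * (S + 1) \<le> m\<close>; the bound 1 keeps the step admissible.\<close>
    define \<theta> where "\<theta> = min 1 (m / (S + 1))"
    have "m > 0" "S \<ge> 0"
      using neg by (auto simp: m_def S_def intro: sum_nonneg)
    have "\<theta> \<le> m / (S + 1)"
      by (simp add: \<theta>_def)
    with \<open>S \<ge> 0\<close> have "\<theta> * (S + 1) \<le> m"
      by (simp add: pos_le_divide_eq)
    moreover have "0 < \<theta>" "\<theta> \<le> 1"
      using \<open>m > 0\<close> \<open>S \<ge> 0\<close> by (simp_all add: \<theta>_def)
    ultimately have \<theta>: "0 < \<theta>" "\<theta> \<le> 1" "\<theta> * (S + 1) \<le> m"
      by simp_all
    have "(\<Sum>e\<in>E. (t e)\<^sup>2) \<le> (\<Sum>e\<in>E. (t e + \<theta> * s e)\<^sup>2)"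
    proof (rule min[of "(1 - \<theta>) *\<^sub>R p + \<theta> *\<^sub>R q"])
      show "(1 - \<theta>) *\<^sub>R p + \<theta> *\<^sub>R q \<in> P"
        using polytope_imp_convex[OF P] p q \<theta> by (simp add: convex_alt)
      show "\<forall>e\<in>E. \<bar>t e + \<theta> * s e\<bar> \<le> 1"
      proof
        fix e assume e: "e \<in> E"
        have "\<theta> * s e \<le> \<theta> * (1 - t e)" "\<theta> * (- 1 - t e) \<le> \<theta> * s e"
          using s e \<theta> by (auto intro!: mult_left_mono)
        moreover have "\<theta> * (1 - t e) \<le> 1 * (1 - t e)" "\<theta> * (1 + t e) \<le> 1 * (1 + t e)"
          using t e \<theta> by (intro mult_right_mono; force simp: abs_le_iff)+
        ultimately show "\<bar>t e + \<theta> * s e\<bar> \<le> 1"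
          by (simp add: abs_le_iff algebra_simps)
      qed
      have "(\<Sum>e\<in>E. (t e + \<theta> * s e) *\<^sub>R e) =
          (\<Sum>e\<in>E. t e *\<^sub>R e) + \<theta> *\<^sub>R (\<Sum>e\<in>E. s e *\<^sub>R e)"
        by (simp add: algebra_simps sum.distrib scaleR_sum_right)
      moreover have "(\<Sum>e\<in>E. s e *\<^sub>R e) = p - q"
        using qp by (simp add: algebra_simps)
      ultimately show "x = (1 - \<theta>) *\<^sub>R p + \<theta> *\<^sub>R q + (\<Sum>e\<in>E. (t e + \<theta> * s e) *\<^sub>R e)"
        by (simp add: x algebra_simps)
    qed
    also have "\<dots> = (\<Sum>e\<in>E. (t e)\<^sup>2) + \<theta> * (\<theta> * S - 2 * m)"
      unfolding m_def S_def
      by (simp add: power2_eq_square algebra_simps sum.distrib sum_distrib_left sum_distrib_right)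
    finally have "0 \<le> \<theta> * S - 2 * m"
      using \<theta>(1) by (simp add: zero_le_mult_iff)
    then show False
      using \<theta> \<open>m > 0\<close> by (simp add: algebra_simps)
  qed
  have "closed (conic hull K)"
    by (rule closed_conic_hull_strong) (simp add: polK)
  then obtain y c where y: "y \<bullet> (0, -1) < c" "\<And>z. z \<in> conic hull K \<Longrightarrow> c < y \<bullet> z"
    using separating_hyperplane_closed_point[OF _ _ notin] polytope_imp_convex[OF polK]
      convex_conic_hull by metis
  obtain a b where ab: "y = (a, b)"
    by (cases y)
  have "0 \<in> K"
    using KI[OF p, of "\<lambda>_. 0"] t by (auto simp: abs_le_iff simp flip: zero_prod_def)
  then have "c < 0"
    using y(2)[of 0] hull_inc by fastforce
  \<comment> \<open>The objective has positive weight in the multiplier; this makes the final sign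
    condition strict.\<close>
  then have "b > 0"
    using y(1) ab by simp
  have nonneg: "0 \<le> y \<bullet> k" if "k \<in> K" for k
  proof (rule ccontr)
    assume "\<not> 0 \<le> y \<bullet> k"
    then have "0 \<le> c / (y \<bullet> k)"
      using \<open>c < 0\<close> by (simp add: divide_nonpos_neg)
    then have "(c / (y \<bullet> k)) *\<^sub>R k \<in> conic hull K"
      using that conic_conic_hull conic_mul hull_inc by metis
    from y(2)[OF this] show False
      using \<open>\<not> 0 \<le> y \<bullet> k\<close> by simp
  qed
  show thesis
  proof (rule that[OF p t x, of "- a"])
    show "\<forall>q\<in>P. - a \<bullet> q \<le> - a \<bullet> p"
    proof
      fix q assume "q \<in> P"
      then show "- a \<bullet> q \<le> - a \<bullet> p"
        using nonneg[OF KI[OF \<open>q \<in> P\<close>, of "\<lambda>_. 0"]] t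
        by (auto simp: ab abs_le_iff inner_diff_right)
    qed
    show "\<forall>e\<in>E. t e \<noteq> 0 \<longrightarrow> 0 < t e * (- a \<bullet> e)"
    proof (intro ballI impI)
      fix e assume e: "e \<in> E" and "t e \<noteq> 0"
      \<comment> \<open>The move that tests the sign of \<open>t e\<close> resets this one
        coefficient to 0 and keeps everything else.\<close>
      have "(\<Sum>d\<in>E. (if d = e then - t e else 0) *\<^sub>R f d) = - t e *\<^sub>R f e"
      proof -
        have "(\<Sum>d\<in>E. (if d = e then - t e else 0) *\<^sub>R f d) = (\<Sum>d\<in>E. if d = e then - t e *\<^sub>R f e else 0)"
          by (rule sum.cong) auto
        then show ?thesis
          using E e by simp
      qed
      then have "- t e *\<^sub>R f e \<in> K"
        using KI[OF p, of "\<lambda>d. if d = e then - t e else 0"] t by (auto simp: abs_le_iff zero_prod_def[symmetric])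
      from nonneg[OF this] have "t e * (a \<bullet> e) + b * (t e)\<^sup>2 \<le> 0"
        by (simp add: ab f_def algebra_simps power2_eq_square)
      moreover have "b * (t e)\<^sup>2 > 0"
        using \<open>b > 0\<close> \<open>t e \<noteq> 0\<close> by simp
      ultimately show "0 < t e * (- a \<bullet> e)"
        by simp
    qed
  qed
qed

subsection \<open>Generic functionals and maximizers\<close>

text \<open>A hyperplane has empty interior, so removing finitely many, one at a time, leaves a
  non-empty open set.\<close>

lemma open_avoids_hyperplanes:
  fixes S :: "'a::euclidean_space set"
  assumes "finite B" "open S" "S \<noteq> {}"
  shows "\<exists>u\<in>S. \<forall>b\<in>B. b \<noteq> 0 \<longrightarrow> u \<bullet> b \<noteq> 0"
  using assms
proof (induction B arbitrary: S)
  case (insert b B)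
  show ?case
  proof (cases "b = 0")
    case True
    with insert.IH[OF insert.prems] show ?thesis by auto
  next
    case False
    have "interior {u. b \<bullet> u = 0} = {}"
      using False by (rule interior_hyperplane)
    then have "\<not> S \<subseteq> {u. b \<bullet> u = 0}"
      using insert.prems interior_maximal[of S] by blast
    then have "S \<inter> {u. u \<bullet> b \<noteq> 0} \<noteq> {}"
      by (auto simp: inner_commute)
    moreover have "open {u. u \<bullet> b \<noteq> 0}"
      by (intro open_Collect_neq continuous_intros)
    ultimately show ?thesis
      using insert.IH[of "S \<inter> {u. u \<bullet> b \<noteq> 0}"] insert.prems by (auto simp: open_Int)
  qed
qed auto

text \<open>For small \<open>r > 0\<close>, \<open>u0 + r *\<^sub>R u1\<close> is positive on
  \<open>D\<close>. Positivity on a finite set is an open condition, which leaves room to avoid the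
  hyperplanes normal to \<open>B\<close>. With \<open>u1 = 0\<close> this only makes
  \<open>u0\<close> generic.\<close>

lemma generic_lexicographic_perturbation:
  fixes u0 u1 :: "'a::euclidean_space"
  assumes "finite D" "finite B"
    and pos: "\<And>d. d \<in> D \<Longrightarrow> 0 < u0 \<bullet> d \<or> u0 \<bullet> d = 0 \<and> 0 < u1 \<bullet> d"
  obtains u where "\<forall>d\<in>D. 0 < u \<bullet> d" "\<forall>b\<in>B. b \<noteq> 0 \<longrightarrow> u \<bullet> b \<noteq> 0"
proof -
  have "eventually (\<lambda>r. 0 < (u0 + r *\<^sub>R u1) \<bullet> d) (at_right 0)" if "d \<in> D" for d
    using pos[OF that]
  proof
    assume "0 < u0 \<bullet> d"
    moreover have "((\<lambda>r. (u0 + r *\<^sub>R u1) \<bullet> d) \<longlongrightarrow> (u0 + 0 *\<^sub>R u1) \<bullet> d) (at_right 0)"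
      by (intro tendsto_intros)
    ultimately show ?thesis
      using order_tendstoD(1) by fastforce
  next
    assume "u0 \<bullet> d = 0 \<and> 0 < u1 \<bullet> d"
    then show ?thesis
      using eventually_at_right_less[of "0::real"] by (auto simp: inner_add_left elim!: eventually_mono)
  qed
  then have "eventually (\<lambda>r. \<forall>d\<in>D. 0 < (u0 + r *\<^sub>R u1) \<bullet> d) (at_right (0::real))"
    using \<open>finite D\<close> by (simp add: eventually_ball_finite)
  then obtain r where r: "\<forall>d\<in>D. 0 < (u0 + r *\<^sub>R u1) \<bullet> d"
    using eventually_happens' trivial_limit_at_right_real by blast
  have "{u. \<forall>d\<in>D. 0 < u \<bullet> d} = (\<Inter>d\<in>D. {u. 0 < u \<bullet> d})"
    by auto
  moreover have "open (\<Inter>d\<in>D. {u. 0 < u \<bullet> d})"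
    using \<open>finite D\<close> by (intro open_INT ballI open_Collect_less continuous_intros)
  ultimately have "open {u. \<forall>d\<in>D. 0 < u \<bullet> d}"
    by simp
  moreover have "{u. \<forall>d\<in>D. 0 < u \<bullet> d} \<noteq> {}"
    using r by blast
  ultimately have "\<exists>u\<in>{u. \<forall>d\<in>D. 0 < u \<bullet> d}. \<forall>b\<in>B. b \<noteq> 0 \<longrightarrow> u \<bullet> b \<noteq> 0"
    by (rule open_avoids_hyperplanes[OF \<open>finite B\<close>])
  then show thesis
    using that by blast
qed

lemma strict_maximizer_exists:
  assumes "finite A" "A \<noteq> {}" and "\<forall>b\<in>{v - w | v w. v \<in> A \<and> w \<in> A}. b \<noteq> 0 \<longrightarrow> u \<bullet> b \<noteq> 0"
  obtains a where "a \<in> A" "\<forall>v\<in>A - {a}. u \<bullet> v < u \<bullet> (a::'a::euclidean_space)"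
proof -
  obtain a where a: "a \<in> A" "\<forall>v\<in>A. u \<bullet> v \<le> u \<bullet> a"
    using continuous_attains_sup[OF finite_imp_compact[OF assms(1)] assms(2), of "\<lambda>v. u \<bullet> v"]
      continuous_on_inner[OF continuous_on_const continuous_on_id] by blast
  show thesis
  proof (rule that[OF a(1)], intro ballI)
    fix v assume v: "v \<in> A - {a}"
    then have "u \<bullet> (a - v) \<noteq> 0"
      using assms(3) a(1) by (metis (mono_tags, lifting) DiffE eq_iff_diff_eq_0 mem_Collect_eq singletonI)
    then show "u \<bullet> v < u \<bullet> a"
      using a(2) v by (auto simp: inner_diff_right order.strict_iff_order)
  qed
qed

lemma strict_maximizer_convex_hull:
  assumes "a \<in> A" "\<forall>v\<in>A - {a}. u \<bullet> v < u \<bullet> a" "x \<in> convex hull A"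
  shows "u \<bullet> x \<le> u \<bullet> a" and "u \<bullet> x = u \<bullet> a \<Longrightarrow> x = (a::'a::euclidean_space)"
proof -
  have "u \<bullet> x \<le> u \<bullet> a \<and> (u \<bullet> x = u \<bullet> a \<longrightarrow> x = a)"
  proof (cases "A = {a}")
    case True
    then show ?thesis using assms by auto
  next
    case False
    then have "A - {a} \<noteq> {}" using assms(1) by auto
    moreover have "x \<in> convex hull (insert a (A - {a}))"
      using assms by (simp add: insert_absorb)
    ultimately obtain r s b where rs: "r \<ge> 0" "s \<ge> 0" "r + s = 1" "b \<in> convex hull (A - {a})"
      "x = r *\<^sub>R a + s *\<^sub>R b"
      unfolding convex_hull_insert[OF \<open>A - {a} \<noteq> {}\<close>] by blast
    have "convex hull (A - {a}) \<subseteq> {y. u \<bullet> y < u \<bullet> a}"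
      using assms(2) by (intro hull_minimal convex_halfspace_lt) auto
    then have "u \<bullet> b < u \<bullet> a"
      using rs(4) by auto
    moreover have "u \<bullet> x = u \<bullet> a - s * (u \<bullet> a - u \<bullet> b)"
      using rs(3) unfolding rs(5) by (simp add: algebra_simps flip: distrib_right)
    ultimately show ?thesis
      using rs by (auto simp: mult_nonneg_nonneg)
  qed
  then show "u \<bullet> x \<le> u \<bullet> a" and "u \<bullet> x = u \<bullet> a \<Longrightarrow> x = a"
    by auto
qed

lemma unique_maximizer_extreme_point:
  assumes "w \<in> Q" and "\<And>q. q \<in> Q \<Longrightarrow> u \<bullet> q \<le> u \<bullet> w" and "\<And>q. q \<in> Q \<Longrightarrow> u \<bullet> q = u \<bullet> w \<Longrightarrow> q = w"
  shows "w extreme_point_of (Q :: 'a::euclidean_space set)"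
  unfolding extreme_point_of_def
proof (intro conjI ballI notI)
  fix x y assume xy: "x \<in> Q" "y \<in> Q" and "w \<in> open_segment x y"
  then obtain r where r: "0 < r" "r < 1" "w = (1 - r) *\<^sub>R x + r *\<^sub>R y" "x \<noteq> y"
    by (auto simp: in_segment)
  have "(1 - r) * (u \<bullet> w - u \<bullet> x) + r * (u \<bullet> w - u \<bullet> y) = 0"
    using arg_cong[OF r(3), of "\<lambda>z. u \<bullet> z"] by (simp add: algebra_simps)
  moreover have "0 \<le> (1 - r) * (u \<bullet> w - u \<bullet> x)" "0 \<le> r * (u \<bullet> w - u \<bullet> y)"
    using r assms(2) xy by auto
  ultimately have "u \<bullet> x = u \<bullet> w" "u \<bullet> y = u \<bullet> w"
    using r by (auto simp: add_nonneg_eq_0_iff)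
  then show False
    using assms(3) xy r(4) by metis
qed (rule assms(1))

text \<open>The weighted deficits \<open>l v * (u \<bullet> p - u \<bullet> v)\<close> are
  nonnegative and sum to 0, so no weight lies off the face.\<close>

lemma convex_hull_maximizer_face:
  fixes p :: "'a::euclidean_space"
  assumes "finite W" "p \<in> convex hull W" "\<forall>v\<in>W. u \<bullet> v \<le> u \<bullet> p"
  shows "p \<in> convex hull {v\<in>W. u \<bullet> v = u \<bullet> p}"
proof -
  obtain l where l: "\<forall>v\<in>W. 0 \<le> l v" "sum l W = 1" "(\<Sum>v\<in>W. l v *\<^sub>R v) = p"
    using assms(1,2) by (auto simp: convex_hull_finite)
  have "(\<Sum>v\<in>W. l v * (u \<bullet> p - u \<bullet> v)) = sum l W * (u \<bullet> p) - u \<bullet> (\<Sum>v\<in>W. l v *\<^sub>R v)"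
    by (simp add: inner_sum_right algebra_simps sum_subtractf sum_distrib_right)
  then have "(\<Sum>v\<in>W. l v * (u \<bullet> p - u \<bullet> v)) = 0"
    using l by simp
  then have "\<forall>v\<in>W. l v * (u \<bullet> p - u \<bullet> v) = 0"
    using assms l(1) by (subst (asm) sum_nonneg_eq_0_iff) auto
  then have l0: "\<forall>v\<in>W - {v\<in>W. u \<bullet> v = u \<bullet> p}. l v = 0"
    by auto
  have "sum l {v\<in>W. u \<bullet> v = u \<bullet> p} = sum l W"
    using l0 assms(1) by (intro sum.mono_neutral_left) auto
  moreover have "(\<Sum>v\<in>{v\<in>W. u \<bullet> v = u \<bullet> p}. l v *\<^sub>R v) = (\<Sum>v\<in>W. l v *\<^sub>R v)"
    using l0 assms(1) by (intro sum.mono_neutral_left) auto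
  ultimately show ?thesis
    using l assms(1) by (auto simp: convex_hull_finite intro!: exI[of _ l])
qed

subsection \<open>Covering a polytope by half-size copies at its vertices\<close>

text \<open>
  For a generic \<open>u\<close> as below, the vertex of the hull of \<open>A\<close> plus the segments from \<open>- e\<close> to \<open>e\<close> that
  maximizes \<open>u\<close> is \<open>w = a + (\<Sum>e\<in>E. sgn (u \<bullet> e) *\<^sub>R e)\<close>, and then
  \<open>2p - w = b + (\<Sum>e\<in>E. (2 * c e - sgn (u \<bullet> e)) *\<^sub>R e)\<close> has all coefficients in \<open>[-1, 1]\<close>.
\<close>

definition half_covered :: "'a::euclidean_space set \<Rightarrow> 'a set \<Rightarrow> 'a \<Rightarrow> bool" where
  "half_covered A E p \<longleftrightarrow> (\<exists>u c. \<exists>a\<in>A. \<exists>b\<in>convex hull A.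
    (\<forall>v\<in>A - {a}. u \<bullet> v < u \<bullet> a) \<and> p = midpoint a b + (\<Sum>e\<in>E. c e *\<^sub>R e) \<and>
    (\<forall>e\<in>E. \<bar>c e\<bar> \<le> 1 \<and> (c e \<noteq> 0 \<longrightarrow> 0 < c e * (u \<bullet> e))))"

lemma half_covered_mono:
  assumes "half_covered A E p" "E \<subseteq> E'" "finite E'"
  shows "half_covered A E' p"
proof -
  obtain u c a b where h: "a \<in> A" "b \<in> convex hull A" "\<forall>v\<in>A - {a}. u \<bullet> v < u \<bullet> a"
    "p = midpoint a b + (\<Sum>e\<in>E. c e *\<^sub>R e)" "\<forall>e\<in>E. \<bar>c e\<bar> \<le> 1 \<and> (c e \<noteq> 0 \<longrightarrow> 0 < c e * (u \<bullet> e))"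
    using assms(1) by (auto simp: half_covered_def)
  define c' where "c' e = (if e \<in> E then c e else 0)" for e
  have "(\<Sum>e\<in>E. c e *\<^sub>R e) = (\<Sum>e\<in>E'. c' e *\<^sub>R e)"
    using assms(2,3) by (intro sum.mono_neutral_cong_left) (auto simp: c'_def)
  then show ?thesis
    unfolding half_covered_def using h
    by (intro exI[of _ u] exI[of _ c'] bexI[of _ a] bexI[of _ b]) (auto simp: c'_def)
qed

text \<open>Directions parallel to the hull: a functional that is constant on \<open>A\<close>
  vanishes on them.\<close>

definition convex_hull_diffs :: "'a::real_vector set \<Rightarrow> 'a set" where
  "convex_hull_diffs A = {x - y | x y. x \<in> convex hull A \<and> y \<in> convex hull A}"

text \<open>Near \<open>p\<close> the hull stays strictly above \<open>m = midpoint a b\<close> in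
  direction \<open>u\<close>. Cutting it with a box leaves the hull of a finite set
  \<open>Y\<close>; each \<open>y - m\<close> has positive \<open>u\<close>-value, and convex
  weights serve as coefficients.\<close>

lemma half_covered_neighbourhood:
  fixes p :: "'a::euclidean_space"
  assumes a: "a \<in> A" and A: "finite A" and b: "b \<in> convex hull A"
    and strict: "\<forall>v\<in>A - {a}. u \<bullet> v < u \<bullet> a" and p: "u \<bullet> a + u \<bullet> b < 2 * (u \<bullet> p)"
  obtains T E where "open T" "p \<in> T" "finite E" "E \<subseteq> convex_hull_diffs A"
    "\<forall>x\<in>T \<inter> convex hull A. half_covered A E x"
proof -
  have "open {x. u \<bullet> a + u \<bullet> b < 2 * (u \<bullet> x)}"
    by (intro open_Collect_less continuous_intros)
  then obtain l r where lr: "cbox l r \<subseteq> {x. u \<bullet> a + u \<bullet> b < 2 * (u \<bullet> x)}" "p \<in> box l r"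
    using p open_contains_cbox by (metis mem_Collect_eq)
  have "polytope (convex hull A \<inter> cbox l r)"
    using A by (simp add: polytope_Int polytope_convex_hull polytope_interval)
  then obtain Y where Y: "finite Y" "convex hull A \<inter> cbox l r = convex hull Y"
    by (auto simp: polytope_def)
  define m where "m = midpoint a b"
  have "a \<in> convex hull A"
    using a hull_inc by fast
  then have m: "m \<in> convex hull A"
    unfolding m_def using b convex_convex_hull midpoint_in_closed_segment closed_segment_subset by blast
  have YA: "Y \<subseteq> convex hull A \<inter> cbox l r"
    unfolding Y(2) by (rule hull_subset)
  have um: "2 * (u \<bullet> m) = u \<bullet> a + u \<bullet> b"
    by (simp add: m_def midpoint_def algebra_simps)
  show thesis
  proof (rule that)
    show "open (box l r)" "p \<in> box l r" "finite ((\<lambda>y. y - m) ` Y)"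
      using lr Y by auto
    show "(\<lambda>y. y - m) ` Y \<subseteq> convex_hull_diffs A"
      using YA m by (auto simp: convex_hull_diffs_def)
    show "\<forall>x\<in>box l r \<inter> convex hull A. half_covered A ((\<lambda>y. y - m) ` Y) x"
    proof
      fix x assume "x \<in> box l r \<inter> convex hull A"
      then have "x \<in> convex hull Y"
        using Y(2) box_subset_cbox by blast
      then obtain k where k: "\<forall>y\<in>Y. 0 \<le> k y" "sum k Y = 1" "(\<Sum>y\<in>Y. k y *\<^sub>R y) = x"
        using Y(1) by (auto simp: convex_hull_finite)
      have k1: "k y \<le> 1" if "y \<in> Y" for y
        using member_le_sum[OF that, of k] k Y(1) by auto
      define c where "c e = k (e + m)" for e
      have "(\<Sum>e\<in>(\<lambda>y. y - m) ` Y. c e *\<^sub>R e) = (\<Sum>y\<in>Y. k y *\<^sub>R (y - m))"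
        by (subst sum.reindex) (auto simp: c_def inj_on_def)
      also have "\<dots> = x - m"
        using k by (simp add: scaleR_diff_right sum_subtractf flip: scaleR_sum_left)
      finally have "x = m + (\<Sum>e\<in>(\<lambda>y. y - m) ` Y. c e *\<^sub>R e)"
        by simp
      moreover have "\<bar>c e\<bar> \<le> 1 \<and> (c e \<noteq> 0 \<longrightarrow> 0 < c e * (u \<bullet> e))" if "e \<in> (\<lambda>y. y - m) ` Y" for e
      proof -
        obtain y where y: "y \<in> Y" "e = y - m" using \<open>e \<in> _\<close> by auto
        then have "0 < u \<bullet> e"
          using YA lr(1) um by (auto simp: inner_diff_right)
        then show ?thesis
          using y k k1 by (auto simp: c_def less_eq_real_def)
      qed
      ultimately show "half_covered A ((\<lambda>y. y - m) ` Y) x"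
        unfolding half_covered_def m_def using a b strict
        by (intro exI[of _ u] exI[of _ c] bexI[of _ a] bexI[of _ b]) auto
    qed
  qed
qed

text \<open>With \<open>b = 2 *\<^sub>R c - a\<close> the midpoint is \<open>c\<close> whatever
  \<open>a\<close> is. So the functional can come first, from a sign-compatible decomposition of
  \<open>x\<close> over the polytope \<open>{c}\<close>; once made generic, it determines
  \<open>a\<close>.\<close>

lemma half_covered_symmetric:
  fixes c :: "'a::euclidean_space"
  assumes A: "finite A" and c: "c \<in> convex hull A"
    and sym: "\<And>b. b \<in> convex hull A \<Longrightarrow> 2 *\<^sub>R c - b \<in> convex hull A"
    and x: "x \<in> convex hull A"
  shows "half_covered A ((\<lambda>v. v - c) ` A) x"
proof -
  let ?E = "(\<lambda>v. v - c) ` A"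
  obtain k where k: "\<forall>v\<in>A. 0 \<le> k v" "sum k A = 1" "(\<Sum>v\<in>A. k v *\<^sub>R v) = x"
    using A x by (auto simp: convex_hull_finite)
  have k1: "k v \<le> 1" if "v \<in> A" for v
    using member_le_sum[OF that, of k] k A by auto
  have "(\<Sum>e\<in>?E. k (e + c) *\<^sub>R e) = (\<Sum>v\<in>A. k v *\<^sub>R (v - c))"
    by (subst sum.reindex) (auto simp: inj_on_def)
  also have "\<dots> = x - c"
    using k by (simp add: scaleR_diff_right sum_subtractf flip: scaleR_sum_left)
  finally have eq: "x = c + (\<Sum>e\<in>?E. k (e + c) *\<^sub>R e)"
    by simp
  have bound: "\<forall>e\<in>?E. \<bar>k (e + c)\<bar> \<le> 1"
    using k k1 by auto
  have "finite ?E"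
    using A by simp
  then obtain u0 t where t: "\<forall>e\<in>?E. \<bar>t e\<bar> \<le> 1" "x = c + (\<Sum>e\<in>?E. t e *\<^sub>R e)"
    "\<forall>e\<in>?E. t e \<noteq> 0 \<longrightarrow> 0 < t e * (u0 \<bullet> e)"
  proof (rule sign_compatible_decomposition[OF _ polytope_sing singletonI bound eq])
    fix u p t assume "p \<in> {c}" "\<forall>e\<in>?E. \<bar>t e\<bar> \<le> 1" "x = p + (\<Sum>e\<in>?E. t e *\<^sub>R e)"
      "\<forall>e\<in>?E. t e \<noteq> 0 \<longrightarrow> 0 < t e * (u \<bullet> e)"
    then show ?thesis
      using that by (metis singletonD)
  qed
  let ?D = "(\<lambda>e. t e *\<^sub>R e) ` {e\<in>?E. t e \<noteq> 0}"
  obtain u where u: "\<forall>d\<in>?D. 0 < u \<bullet> d" "\<forall>b\<in>{v - w | v w. v \<in> A \<and> w \<in> A}. b \<noteq> 0 \<longrightarrow> u \<bullet> b \<noteq> 0"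
  proof (rule generic_lexicographic_perturbation)
    show "finite ?D" "finite {v - w | v w. v \<in> A \<and> w \<in> A}"
      using A by (auto intro: finite_image_set2)
    show "0 < u0 \<bullet> d \<or> u0 \<bullet> d = 0 \<and> 0 < 0 \<bullet> d" if "d \<in> ?D" for d
      using that t(3) by auto
  qed (rule that)
  obtain a where a: "a \<in> A" "\<forall>v\<in>A - {a}. u \<bullet> v < u \<bullet> a"
    by (rule strict_maximizer_exists[OF A _ u(2)]) (use c in auto)
  have "midpoint a (2 *\<^sub>R c - a) = c"
    by (simp add: midpoint_def)
  moreover have "2 *\<^sub>R c - a \<in> convex hull A"
    using a(1) by (intro sym hull_inc)
  ultimately show ?thesis
    unfolding half_covered_def using a t u(1)
    by (intro exI[of _ u] exI[of _ t] bexI[of _ a] bexI[of _ "2 *\<^sub>R c - a"]) auto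
qed

text \<open>
  If \<open>p\<close> admits no vertex \<open>a\<close>, strictly maximal for some \<open>u\<close>, together with a point \<open>b\<close> such that
  \<open>p\<close> lies strictly above the midpoint of \<open>a\<close> and \<open>b\<close>, then separating a missing point \<open>2p - b\<close> from
  the hull shows that \<open>p\<close> is a centre of symmetry.
\<close>

lemma half_covered_locally:
  fixes p :: "'a::euclidean_space"
  assumes A: "finite A" and p: "p \<in> convex hull A"
  obtains T E where "open T" "p \<in> T" "finite E" "E \<subseteq> convex_hull_diffs A"
    "\<forall>x\<in>T \<inter> convex hull A. half_covered A E x"
proof (cases "\<exists>u. \<exists>a\<in>A. \<exists>b\<in>convex hull A. (\<forall>v\<in>A - {a}. u \<bullet> v < u \<bullet> a) \<and>
    u \<bullet> a + u \<bullet> b < 2 * (u \<bullet> p)")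
  case True
  then show thesis
    using half_covered_neighbourhood[OF _ A] that by metis
next
  case False
  have sym: "2 *\<^sub>R p - b \<in> convex hull A" if b: "b \<in> convex hull A" for b
  proof (rule ccontr)
    assume "2 *\<^sub>R p - b \<notin> convex hull A"
    moreover have "closed (convex hull A)"
      using A by (simp add: compact_imp_closed finite_imp_compact_convex_hull)
    ultimately obtain y r where y: "y \<bullet> (2 *\<^sub>R p - b) < r" "\<forall>x\<in>convex hull A. r < y \<bullet> x"
      using separating_hyperplane_closed_point[OF convex_convex_hull] by metis
    \<comment> \<open>The functional \<open>- y\<close> is positive on \<open>?D\<close>. A generic
      \<open>u\<close> keeps this and has a strict maximizer \<open>a\<close>; positivity at
      \<open>2 *\<^sub>R p - b - a\<close> is the inequality that \<open>False\<close>
      excludes.\<close>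
    let ?D = "(\<lambda>v. 2 *\<^sub>R p - b - v) ` A"
    obtain u where u: "\<forall>d\<in>?D. 0 < u \<bullet> d" "\<forall>b\<in>{v - w | v w. v \<in> A \<and> w \<in> A}. b \<noteq> 0 \<longrightarrow> u \<bullet> b \<noteq> 0"
    proof (rule generic_lexicographic_perturbation)
      show "finite ?D" "finite {v - w | v w. v \<in> A \<and> w \<in> A}"
        using A by (auto intro: finite_image_set2)
      show "0 < - y \<bullet> d \<or> - y \<bullet> d = 0 \<and> 0 < 0 \<bullet> d" if d: "d \<in> ?D" for d
      proof -
        obtain v where v: "v \<in> A" "d = 2 *\<^sub>R p - b - v" using d by auto
        then have "r < y \<bullet> v" using y(2) hull_inc by fast
        then show ?thesis using y(1) v by (simp add: inner_diff_right)
      qed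
    qed (rule that)
    obtain a where a: "a \<in> A" "\<forall>v\<in>A - {a}. u \<bullet> v < u \<bullet> a"
      by (rule strict_maximizer_exists[OF A _ u(2)]) (use p in auto)
    then have "u \<bullet> a + u \<bullet> b < 2 * (u \<bullet> p)"
      using u(1) by (auto simp: inner_diff_right)
    then show False
      using False a b by blast
  qed
  show thesis
  proof (rule that)
    show "open UNIV" "p \<in> UNIV" "finite ((\<lambda>v. v - p) ` A)"
      using A by auto
    show "(\<lambda>v. v - p) ` A \<subseteq> convex_hull_diffs A"
      using p by (auto simp: convex_hull_diffs_def intro: hull_inc)
    show "\<forall>x\<in>UNIV \<inter> convex hull A. half_covered A ((\<lambda>v. v - p) ` A) x"
      using half_covered_symmetric[OF A p sym] by blast
  qed
qed

text \<open>Finitely many local neighbourhoods cover the compact hull, and by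
  \<open>half_covered_mono\<close> their direction sets may be united.\<close>

lemma half_covering_segments:
  assumes A: "finite A"
  shows "\<exists>E. finite E \<and> E \<subseteq> convex_hull_diffs A \<and>
    (\<forall>x\<in>convex hull A. half_covered A E (x::'a::euclidean_space))"
proof -
  have "\<forall>p\<in>convex hull A. \<exists>T E. open T \<and> p \<in> T \<and> finite E \<and> E \<subseteq> convex_hull_diffs A \<and>
      (\<forall>x\<in>T \<inter> convex hull A. half_covered A E x)"
    by (metis half_covered_locally[OF A])
  then obtain T E where TE: "\<And>p. p \<in> convex hull A \<Longrightarrow> open (T p) \<and> p \<in> T p \<and> finite (E p) \<and>
      E p \<subseteq> convex_hull_diffs A \<and> (\<forall>x\<in>T p \<inter> convex hull A. half_covered A (E p) x)"
    by metis
  obtain C where C: "C \<subseteq> convex hull A" "finite C" "convex hull A \<subseteq> (\<Union>p\<in>C. T p)"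
    using compactE_image[OF finite_imp_compact_convex_hull[OF A], of "convex hull A" T] TE by blast
  have fin: "finite (\<Union>p\<in>C. E p)"
    using C TE by blast
  show ?thesis
  proof (intro exI conjI ballI)
    show "(\<Union>p\<in>C. E p) \<subseteq> convex_hull_diffs A"
      using C TE by blast
    fix x assume x: "x \<in> convex hull A"
    then obtain p where p: "p \<in> C" "x \<in> T p"
      using C by blast
    then have "half_covered A (E p) x"
      using C TE x by blast
    then show "half_covered A (\<Union>p\<in>C. E p) x"
      by (rule half_covered_mono) (use p fin in auto)
  qed (rule fin)
qed

subsection \<open>Vertex generation\<close>

text \<open>Maximizing \<open>u\<close> over a Minkowski sum splits into maximizing over each
  summand, where the maximizer is unique by hypothesis.\<close>

lemma generic_vertex:
  fixes a :: "'a::euclidean_space"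
  assumes E: "finite E" and a: "a \<in> W" "\<forall>v\<in>W - {a}. u \<bullet> v < u \<bullet> a"
    and u: "\<forall>e\<in>E. e \<noteq> 0 \<longrightarrow> u \<bullet> e \<noteq> 0"
  shows "a + (\<Sum>e\<in>E. sgn (u \<bullet> e) *\<^sub>R e) extreme_point_of
    (convex hull W + (\<Sum>e\<in>E. closed_segment (- e) e))"
proof (rule unique_maximizer_extreme_point)
  let ?w = "\<Sum>e\<in>E. sgn (u \<bullet> e) *\<^sub>R e"
  show "a + ?w \<in> convex hull W + (\<Sum>e\<in>E. closed_segment (- e) e)"
    unfolding sum_segments_symmetric[OF E] using a(1)
    by (intro set_plus_intro hull_inc) (auto simp: abs_sgn_eq)
  fix q assume "q \<in> convex hull W + (\<Sum>e\<in>E. closed_segment (- e) e)"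
  then obtain p s where q: "q = p + (\<Sum>e\<in>E. s e *\<^sub>R e)" and p: "p \<in> convex hull W"
    and s: "\<forall>e\<in>E. \<bar>s e\<bar> \<le> 1"
    unfolding sum_segments_symmetric[OF E] by (auto elim!: set_plus_elim)
  have le: "s e * (u \<bullet> e) \<le> \<bar>u \<bullet> e\<bar>" if "e \<in> E" for e
  proof -
    have "\<bar>s e\<bar> * \<bar>u \<bullet> e\<bar> \<le> 1 * \<bar>u \<bullet> e\<bar>"
      using s that by (intro mult_right_mono) auto
    then show ?thesis
      by (simp flip: abs_mult)
  qed
  have uw: "u \<bullet> ?w = (\<Sum>e\<in>E. \<bar>u \<bullet> e\<bar>)"
    by (simp add: inner_sum_right sgn_mult_self_eq abs_sgn mult.commute)
  have us: "u \<bullet> (\<Sum>e\<in>E. s e *\<^sub>R e) = (\<Sum>e\<in>E. s e * (u \<bullet> e))"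
    by (simp add: inner_sum_right)
  have sum_le: "(\<Sum>e\<in>E. s e * (u \<bullet> e)) \<le> (\<Sum>e\<in>E. \<bar>u \<bullet> e\<bar>)"
    by (rule sum_mono) (rule le)
  have pa: "u \<bullet> p \<le> u \<bullet> a"
    by (rule strict_maximizer_convex_hull[OF a p])
  show "u \<bullet> q \<le> u \<bullet> (a + ?w)"
    using sum_le pa by (simp add: q inner_add_right uw us)
  assume "u \<bullet> q = u \<bullet> (a + ?w)"
  then have "u \<bullet> p = u \<bullet> a" and eq: "(\<Sum>e\<in>E. s e * (u \<bullet> e)) = (\<Sum>e\<in>E. \<bar>u \<bullet> e\<bar>)"
    using sum_le pa by (simp_all add: q inner_add_right uw us)
  then have "p = a"
    using strict_maximizer_convex_hull(2)[OF a p] by simp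
  \<comment> \<open>Termwise bounds whose sums agree are tight one by one; for \<open>e = 0\<close>
    the vectors agree even if the coefficients differ.\<close>
  moreover have "s e *\<^sub>R e = sgn (u \<bullet> e) *\<^sub>R e" if e: "e \<in> E" for e
  proof (cases "e = 0")
    case False
    have "s e * (u \<bullet> e) = \<bar>u \<bullet> e\<bar>"
      by (rule sum_mono_inv[OF eq le e E])
    also have "\<dots> = sgn (u \<bullet> e) * (u \<bullet> e)"
      by (simp add: abs_sgn mult.commute)
    finally show ?thesis
      using u e False by simp
  qed simp
  ultimately show "q = a + ?w"
    unfolding q by (simp only: cong: sum.cong)
qed

text \<open>The face exposed by \<open>u0\<close> depends on \<open>x\<close>, hence
  \<open>cover\<close> speaks of all subsets of \<open>W\<close>.\<close>

lemma exists_reflecting_vertex: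
  fixes x :: "'a::euclidean_space"
  assumes W: "finite W" and E: "finite E"
    and x: "x \<in> convex hull W + (\<Sum>e\<in>E. closed_segment (- e) e)"
    and cover: "\<And>A p. A \<subseteq> W \<Longrightarrow> p \<in> convex hull A \<Longrightarrow>
      \<exists>E'\<subseteq>E. E' \<subseteq> convex_hull_diffs A \<and> half_covered A E' p"
  obtains w where "w extreme_point_of (convex hull W + (\<Sum>e\<in>E. closed_segment (- e) e))"
    "2 *\<^sub>R x - w \<in> convex hull W + (\<Sum>e\<in>E. closed_segment (- e) e)"
proof -
  obtain p0 t0 where "p0 \<in> convex hull W" "\<forall>e\<in>E. \<bar>t0 e\<bar> \<le> 1" "x = p0 + (\<Sum>e\<in>E. t0 e *\<^sub>R e)"
    using x unfolding sum_segments_symmetric[OF E] by (auto elim!: set_plus_elim)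
  then obtain u0 p t where p: "p \<in> convex hull W" and t: "\<forall>e\<in>E. \<bar>t e\<bar> \<le> 1"
    and x_eq: "x = p + (\<Sum>e\<in>E. t e *\<^sub>R e)" and u0: "\<forall>q\<in>convex hull W. u0 \<bullet> q \<le> u0 \<bullet> p"
    and t_sign: "\<forall>e\<in>E. t e \<noteq> 0 \<longrightarrow> 0 < t e * (u0 \<bullet> e)"
    by (rule sign_compatible_decomposition[OF E polytope_convex_hull[OF W]]) (rule that)
  have u0W: "\<forall>v\<in>W. u0 \<bullet> v \<le> u0 \<bullet> p"
    using u0 by (simp add: hull_inc)
  define A where "A = {v\<in>W. u0 \<bullet> v = u0 \<bullet> p}"
  have pA: "p \<in> convex hull A"
    unfolding A_def by (rule convex_hull_maximizer_face[OF W p u0W])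
  have "A \<subseteq> W"
    by (auto simp: A_def)
  then obtain E' where E': "E' \<subseteq> E" "E' \<subseteq> convex_hull_diffs A" "half_covered A E' p"
    using cover[OF _ pA] by metis
  obtain u1 c a b where a: "a \<in> A" and b: "b \<in> convex hull A"
    and strict: "\<forall>v\<in>A - {a}. u1 \<bullet> v < u1 \<bullet> a"
    and p_eq: "p = midpoint a b + (\<Sum>e\<in>E'. c e *\<^sub>R e)"
    and c: "\<forall>e\<in>E'. \<bar>c e\<bar> \<le> 1 \<and> (c e \<noteq> 0 \<longrightarrow> 0 < c e * (u1 \<bullet> e))"
    using E'(3) by (auto simp: half_covered_def)
  \<comment> \<open>As \<open>u0\<close> is constant on the face, it vanishes on \<open>E'\<close>,
    and signs there are left to \<open>u1\<close>.\<close>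
  have "convex hull A \<subseteq> {y. u0 \<bullet> y = u0 \<bullet> p}"
    by (intro hull_minimal convex_hyperplane) (auto simp: A_def)
  then have u0E': "u0 \<bullet> e = 0" if "e \<in> E'" for e
    using E'(2) that by (auto simp: convex_hull_diffs_def inner_diff_right subset_iff)
  define c' where "c' e = (if e \<in> E' then c e else 0)" for e
  have c'_sum: "(\<Sum>e\<in>E'. c e *\<^sub>R e) = (\<Sum>e\<in>E. c' e *\<^sub>R e)"
    using E'(1) E by (intro sum.mono_neutral_cong_left) (auto simp: c'_def)
  \<comment> \<open>Positivity on \<open>?D1\<close> makes \<open>a\<close> the strict maximizer
    over all of \<open>W\<close>; on \<open>?D2\<close> and \<open>?D3\<close> it gives nonzero
    \<open>t e\<close> and \<open>c' e\<close> the sign of \<open>u \<bullet> e\<close>.\<close>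
  let ?D1 = "(\<lambda>v. a - v) ` (W - {a})"
    and ?D2 = "(\<lambda>e. t e *\<^sub>R e) ` {e\<in>E. t e \<noteq> 0}"
    and ?D3 = "(\<lambda>e. c' e *\<^sub>R e) ` {e\<in>E. c' e \<noteq> 0}"
  obtain u where u: "\<forall>d\<in>?D1 \<union> ?D2 \<union> ?D3. 0 < u \<bullet> d" "\<forall>e\<in>E. e \<noteq> 0 \<longrightarrow> u \<bullet> e \<noteq> 0"
  proof (rule generic_lexicographic_perturbation)
    show "finite (?D1 \<union> ?D2 \<union> ?D3)"
      using W E by simp
    show "finite E"
      by (rule E)
    fix d assume "d \<in> ?D1 \<union> ?D2 \<union> ?D3"
    then consider "d \<in> ?D1" | "d \<in> ?D2" | "d \<in> ?D3"
      by blast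
    then show "0 < u0 \<bullet> d \<or> u0 \<bullet> d = 0 \<and> 0 < u1 \<bullet> d"
    proof cases
      case 1
      then obtain v where v: "v \<in> W" "v \<noteq> a" "d = a - v"
        by auto
      show ?thesis
      proof (cases "v \<in> A")
        case True
        then show ?thesis
          using v a strict by (auto simp: A_def inner_diff_right)
      next
        case False
        then have "u0 \<bullet> v < u0 \<bullet> p"
          using u0W v by (auto simp: A_def order.strict_iff_order)
        then show ?thesis
          using v a by (auto simp: A_def inner_diff_right)
      qed
    next
      case 2
      then show ?thesis
        using t_sign by auto
    next
      case 3
      then show ?thesis
        using c u0E' by (auto simp: c'_def split: if_splits)
    qed
  qed (rule that)
  let ?w = "a + (\<Sum>e\<in>E. sgn (u \<bullet> e) *\<^sub>R e)"
  have "a \<in> W"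
    using a \<open>A \<subseteq> W\<close> by blast
  moreover have "\<forall>v\<in>W - {a}. u \<bullet> v < u \<bullet> a"
  proof
    fix v assume "v \<in> W - {a}"
    then have "0 < u \<bullet> (a - v)"
      using u(1) by blast
    then show "u \<bullet> v < u \<bullet> a"
      by (simp add: inner_diff_right)
  qed
  ultimately have "?w extreme_point_of (convex hull W + (\<Sum>e\<in>E. closed_segment (- e) e))"
    by (rule generic_vertex[OF E _ _ u(2)])
  moreover have "2 *\<^sub>R x - ?w \<in> convex hull W + (\<Sum>e\<in>E. closed_segment (- e) e)"
  proof -
    have "2 *\<^sub>R midpoint a b = a + b"
      by (simp add: midpoint_def)
    then have "2 *\<^sub>R x - ?w = b + (\<Sum>e\<in>E. (2 * t e + 2 * c' e - sgn (u \<bullet> e)) *\<^sub>R e)"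
      unfolding x_eq p_eq c'_sum
      by (simp add: scaleR_add_right scaleR_add_left scaleR_diff_left sum.distrib sum_subtractf
          scaleR_sum_right)
    moreover have "b \<in> convex hull W"
      using b hull_mono[OF \<open>A \<subseteq> W\<close>] by blast
    \<comment> \<open>At most one of \<open>t e\<close> and \<open>c' e\<close> is nonzero:
      \<open>u0\<close> vanishes on \<open>E'\<close>, while \<open>t e \<noteq> 0\<close> forces
      \<open>u0 \<bullet> e \<noteq> 0\<close>. Doubling a number in \<open>[-1, 1]\<close> and
      subtracting its sign stays in \<open>[-1, 1]\<close>; if both are 0, minus a sign
      remains.\<close>
    moreover have "\<bar>2 * t e + 2 * c' e - sgn (u \<bullet> e)\<bar> \<le> 1" if e: "e \<in> E" for e
    proof -
      have bound: "\<bar>2 * s - sgn r\<bar> \<le> 1" if "\<bar>s\<bar> \<le> 1" "s \<noteq> 0 \<longrightarrow> 0 < s * r" for s r :: real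
        using that by (cases "s = 0") (auto simp: abs_sgn_eq sgn_if zero_less_mult_iff abs_le_iff)
      show ?thesis
      proof (cases "t e = 0")
        case True
        moreover have "c' e \<noteq> 0 \<longrightarrow> 0 < c' e * (u \<bullet> e)" "\<bar>c' e\<bar> \<le> 1"
          using bspec[OF u(1), of "c' e *\<^sub>R e"] e c by (auto simp: c'_def)
        ultimately show ?thesis
          using bound[of "c' e" "u \<bullet> e"] by simp
      next
        case False
        then have "e \<notin> E'"
          using t_sign e u0E' by fastforce
        moreover have "0 < t e * (u \<bullet> e)"
          using bspec[OF u(1), of "t e *\<^sub>R e"] e False by auto
        ultimately show ?thesis
          using bound[of "t e" "u \<bullet> e"] t e by (simp add: c'_def)
      qed
    qed
    ultimately show ?thesis
      unfolding sum_segments_symmetric[OF E] by (auto intro!: set_plus_intro)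
  qed
  ultimately show thesis
    by (rule that)
qed

text \<open>One inclusion is convexity, through midpoints; the other writes
  \<open>2 *\<^sub>R x\<close> as \<open>(2 *\<^sub>R x - w) + w\<close>.\<close>

lemma vertex_generatedI:
  assumes "polytope Q" "Q \<noteq> {}"
    and "\<And>x. x \<in> Q \<Longrightarrow> \<exists>w. w extreme_point_of Q \<and> 2 *\<^sub>R x - w \<in> Q"
  shows "vertex_generated Q"
  unfolding vertex_generated_def
proof (intro conjI equalityI subsetI)
  fix y assume "y \<in> Q + vertices Q"
  then obtain q w where qw: "y = q + w" "q \<in> Q" "w \<in> Q"
    by (auto simp: vertices_def extreme_point_of_def elim!: set_plus_elim)
  then have "midpoint q w \<in> Q"
    using polytope_imp_convex[OF assms(1)] midpoint_in_closed_segment closed_segment_subset by blast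
  moreover have "y = 2 *\<^sub>R midpoint q w"
    by (simp add: midpoint_def qw(1))
  ultimately show "y \<in> (*\<^sub>R) 2 ` Q"
    by blast
next
  fix y assume "y \<in> (*\<^sub>R) 2 ` Q"
  then obtain x where "x \<in> Q" "y = 2 *\<^sub>R x"
    by blast
  then obtain w where "w extreme_point_of Q" "y - w \<in> Q"
    using assms(3) by blast
  then have "(y - w) + w \<in> Q + vertices Q"
    by (intro set_plus_intro) (auto simp: vertices_def)
  then show "y \<in> Q + vertices Q"
    by simp
qed (use assms in auto)

theorem theorem1p4:
  fixes P :: "(real ^ 'n) set"
  assumes "polytope P" and "P \<noteq> {}"
  shows "\<exists>Z :: (real ^ 'n) set. zonotope Z \<and> vertex_generated (P + Z)"
proof -
  obtain W where W: "finite W" and P: "P = convex hull W"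
    using assms(1) by (auto simp: polytope_def)
  have "\<forall>A\<in>Pow W. \<exists>E. finite E \<and> E \<subseteq> convex_hull_diffs A \<and>
      (\<forall>x\<in>convex hull A. half_covered A E x)"
    using half_covering_segments finite_subset[OF _ W] by blast
  from bchoice[OF this] obtain F where "\<forall>A\<in>Pow W. finite (F A) \<and>
      F A \<subseteq> convex_hull_diffs A \<and> (\<forall>x\<in>convex hull A. half_covered A (F A) x)" ..
  then have F: "finite (F A) \<and> F A \<subseteq> convex_hull_diffs A \<and>
      (\<forall>x\<in>convex hull A. half_covered A (F A) x)" if "A \<subseteq> W" for A
    using that by blast
  \<comment> \<open>One direction set for each subset of \<open>W\<close>, hence for each face that
    may arise, gives a finite \<open>E\<close> independent of \<open>x\<close>.\<close>
  define E where "E = (\<Union>A\<in>Pow W. F A)"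
  have E: "finite E"
    unfolding E_def using W F by blast
  let ?Z = "\<Sum>e\<in>E. closed_segment (- e) e"
  have "vertex_generated (P + ?Z)"
  proof (rule vertex_generatedI)
    show "polytope (P + ?Z)"
      by (intro polytope_set_plus polytope_sum_segments assms E)
    have "0 \<in> ?Z"
      unfolding sum_segments_symmetric[OF E] by (auto intro!: exI[of _ "\<lambda>_. 0"])
    then show "P + ?Z \<noteq> {}"
      using assms(2) by (auto simp: set_plus_def)
    fix x assume "x \<in> P + ?Z"
    then show "\<exists>w. w extreme_point_of (P + ?Z) \<and> 2 *\<^sub>R x - w \<in> P + ?Z"
      unfolding P
    proof (rule exists_reflecting_vertex[OF W E])
      fix A p assume "A \<subseteq> W" "p \<in> convex hull A"
      then show "\<exists>E'\<subseteq>E. E' \<subseteq> convex_hull_diffs A \<and> half_covered A E' p"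
        using F by (intro exI[of _ "F A"]) (auto simp: E_def)
    qed blast
  qed
  with zonotope_sum_segments[OF E] show ?thesis
    by (intro exI[of _ ?Z] conjI)
qed

end
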